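(* Let $P\subset\mathbb{R}^n$ be a non-singleton polytope, let $k=\dim P$, and suppose that $P\in\mathcal{P}_{n,d}$. If $0\le d<\lceil\log_2(k+1)\rceil$, then $$m^*(P)\le 2^d-1.$$
   Context: Define $\mathcal{P}_{n,0}=\{\{x\}:x\in\mathbb{R}^n\}$ and, for $d>0$, $$\mathcal{P}_{n,d}=\Big\{\sum_{j=1}^m\mathsf{conv}(K_j\cup L_j):m\in\mathbb{N},\ K_j,L_j\in\mathcal{P}_{n,d-1}\Big\}$$ (Minkowski sum, $m\ge1$). For a non-singleton compact convex $K\subset\mathbb{R}^n$ and $o\in\operatorname{relint}(K)$, $m_K(o):=\inf\{\alpha\ge 1:-(K-o)\subseteq\alpha(K-o)\}$, and the Minkowski measure of symmetry is $m^*(K):=\inf_{o\in\operatorname{relint}(K)}m_K(o)$ (i.e. the classical Minkowski measure taken in the affine hull of $K$). $\dim P$ is the dimension of the affine hull of $P$. *)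

theory Defs
  imports "HOL-Analysis.Analysis" "HOL-Library.Set_Algebras"
begin

text \<open>
  Addition and finite sums of sets are the Minkowski operations of
  \<^theory>\<open>HOL-Library.Set_Algebras\<close>. The dimension of the ambient space is carried by the type.
\<close>

primrec conv_sum_class :: "nat \<Rightarrow> 'a::euclidean_space set set" where
  "conv_sum_class 0 = {{x} |x. True}"
| "conv_sum_class (Suc d) =
     {\<Sum>j=1..m. convex hull (K j \<union> L j) |(m::nat) K L.
        m \<ge> 1 \<and> (\<forall>j\<in>{1..m}. K j \<in> conv_sum_class d \<and> L j \<in> conv_sum_class d)}"

text \<open>
  Reflection is written as an image because unary minus on sets is the complement.
  For a compact convex set \<open>K\<close> and \<open>c\<close> in its relative interior, the set of admissible
  factors is nonempty and bounded below by 1, so the real infima below are genuine ones.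
\<close>

definition asymmetry_at :: "'a::euclidean_space set \<Rightarrow> 'a \<Rightarrow> real" where
  "asymmetry_at K c =
     Inf {\<alpha>. \<alpha> \<ge> 1 \<and> uminus ` ((\<lambda>x. x - c) ` K) \<subseteq> (\<lambda>x. \<alpha> *\<^sub>R x) ` ((\<lambda>x. x - c) ` K)}"

definition minkowski_measure :: "'a::euclidean_space set \<Rightarrow> real" where
  "minkowski_measure K = (INF c\<in>rel_interior K. asymmetry_at K c)"

end

theory Submission
  imports Defs
begin

text \<open>
  Say that a set absorbs its reflection in one of its points \<open>c\<close> with factor \<open>\<alpha>\<close> if
  \<open>-(K - c) \<subseteq> \<alpha>(K - c)\<close>. A singleton does so with factor \<open>0\<close>, and this, rather than the
  lower bound \<open>1\<close> built into the measure of symmetry, is the right start for an induction: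
  Minkowski sums preserve the factor, because the centres simply add up, while
  \<open>conv(K \<union> L)\<close> absorbs its reflection in the midpoint of the two centres with factor
  \<open>2\<alpha> + 1\<close> (lemma \<open>absorbs_reflection_convex_hull_Un\<close>). Iterating \<open>\<alpha> \<mapsto> 2\<alpha> + 1\<close> from \<open>0\<close>
  gives \<open>2\<^sup>d - 1\<close> after \<open>d\<close> levels.

  A non-singleton has \<open>d \<ge> 1\<close>, so this factor is at least \<open>1\<close> and hence admissible. A centre
  of absorption with positive factor automatically lies in the relative interior, so it competes
  in the infimum defining the measure of symmetry.
\<close>

definition absorbs_reflection :: "real \<Rightarrow> 'a::real_vector \<Rightarrow> 'a set \<Rightarrow> bool" where
  "absorbs_reflection \<alpha> c K \<longleftrightarrow> c \<in> K \<and> (\<forall>x\<in>K. \<exists>y\<in>K. c - x = \<alpha> *\<^sub>R (y - c))"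

lemma absorbs_reflection_sum:
  assumes "finite I" and "\<And>i. i \<in> I \<Longrightarrow> absorbs_reflection \<alpha> (c i) (K i)"
  shows "absorbs_reflection \<alpha> (\<Sum>i\<in>I. c i) (\<Sum>i\<in>I. K i)"
  unfolding absorbs_reflection_def
proof (intro conjI ballI)
  show "(\<Sum>i\<in>I. c i) \<in> (\<Sum>i\<in>I. K i)"
    using assms by (auto simp: set_sum_alt absorbs_reflection_def)
next
  fix x assume "x \<in> (\<Sum>i\<in>I. K i)"
  then obtain s where x: "x = (\<Sum>i\<in>I. s i)" and s: "\<And>i. i \<in> I \<Longrightarrow> s i \<in> K i"
    using assms(1) by (auto simp: set_sum_alt)
  have "\<forall>i\<in>I. \<exists>y. y \<in> K i \<and> c i - s i = \<alpha> *\<^sub>R (y - c i)"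
    using assms(2) s unfolding absorbs_reflection_def by blast
  then obtain y where y: "\<And>i. i \<in> I \<Longrightarrow> y i \<in> K i"
    "\<And>i. i \<in> I \<Longrightarrow> c i - s i = \<alpha> *\<^sub>R (y i - c i)"
    by metis
  have "(\<Sum>i\<in>I. c i) - x = (\<Sum>i\<in>I. c i - s i)"
    by (simp add: x sum_subtractf)
  also have "\<dots> = \<alpha> *\<^sub>R ((\<Sum>i\<in>I. y i) - (\<Sum>i\<in>I. c i))"
    by (simp add: y(2) scaleR_sum_right[symmetric] sum_subtractf)
  finally have "(\<Sum>i\<in>I. c i) - x = \<alpha> *\<^sub>R ((\<Sum>i\<in>I. y i) - (\<Sum>i\<in>I. c i))" .
  moreover have "(\<Sum>i\<in>I. y i) \<in> (\<Sum>i\<in>I. K i)"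
    using assms(1) y(1) by (auto simp: set_sum_alt)
  ultimately show "\<exists>y\<in>\<Sum>i\<in>I. K i. (\<Sum>i\<in>I. c i) - x = \<alpha> *\<^sub>R (y - (\<Sum>i\<in>I. c i))"
    by blast
qed

lemma convex_reflections_absorbed:
  assumes "convex C"
  shows "convex {x. \<exists>y\<in>C. c - x = \<beta> *\<^sub>R (y - c)}"
proof (rule convexI)
  fix x x' :: 'a and u v :: real
  assume uv: "0 \<le> u" "0 \<le> v" "u + v = 1"
    and "x \<in> {x. \<exists>y\<in>C. c - x = \<beta> *\<^sub>R (y - c)}" "x' \<in> {x. \<exists>y\<in>C. c - x = \<beta> *\<^sub>R (y - c)}"
  then obtain y y' where y: "y \<in> C" "c - x = \<beta> *\<^sub>R (y - c)"
    and y': "y' \<in> C" "c - x' = \<beta> *\<^sub>R (y' - c)"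
    by auto
  have affine: "u *\<^sub>R a + v *\<^sub>R b - c = u *\<^sub>R (a - c) + v *\<^sub>R (b - c)" for a b
  proof -
    have "c = (u + v) *\<^sub>R c" using uv by simp
    then show ?thesis by (simp add: algebra_simps)
  qed
  have "c - (u *\<^sub>R x + v *\<^sub>R x') = u *\<^sub>R (c - x) + v *\<^sub>R (c - x')"
    using affine[of x x'] by (simp add: algebra_simps)
  also have "\<dots> = \<beta> *\<^sub>R (u *\<^sub>R y + v *\<^sub>R y' - c)"
    unfolding affine y(2) y'(2) by (simp add: algebra_simps)
  finally show "u *\<^sub>R x + v *\<^sub>R x' \<in> {x. \<exists>y\<in>C. c - x = \<beta> *\<^sub>R (y - c)}"
    using convexD[OF assms y(1) y'(1) uv] by blast
qed

text \<open>
  Put the midpoint at the origin, so that \<open>q = -p\<close>. For a point \<open>p + z\<close> of \<open>K\<close>, pick \<open>p + v\<close> in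
  \<open>K\<close> with \<open>-z = \<alpha>v\<close>. The reflected point is \<open>-p + \<alpha>v = \<alpha>(p + v) + (\<alpha> + 1)q\<close>, which is
  \<open>2\<alpha> + 1\<close> times a convex combination of \<open>p + v\<close> and \<open>q\<close>.
\<close>

lemma midpoint_reflection_in_convex_hull_Un:
  fixes p q :: "'a::real_normed_vector"
  assumes "0 \<le> \<alpha>" "absorbs_reflection \<alpha> p K" "q \<in> L" "x \<in> K"
  shows "\<exists>y\<in>convex hull (K \<union> L). midpoint p q - x = (2 * \<alpha> + 1) *\<^sub>R (y - midpoint p q)"
proof -
  obtain w where w: "w \<in> K" "p - x = \<alpha> *\<^sub>R (w - p)"
    using assms(2,4) by (auto simp: absorbs_reflection_def)
  define y where "y = (\<alpha> / (2 * \<alpha> + 1)) *\<^sub>R w + ((\<alpha> + 1) / (2 * \<alpha> + 1)) *\<^sub>R q"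
  have "y \<in> convex hull (K \<union> L)"
    unfolding y_def using assms(1,3) w(1)
    by (intro convexD[OF convex_convex_hull] hull_inc)
       (simp_all flip: add_divide_distrib)
  moreover have "midpoint p q - x = (2 * \<alpha> + 1) *\<^sub>R (y - midpoint p q)"
  proof -
    have "(2 * \<alpha> + 1) *\<^sub>R y = \<alpha> *\<^sub>R w + (\<alpha> + 1) *\<^sub>R q"
      using assms(1) by (simp add: y_def scaleR_add_right)
    \<comment> \<open>Writing \<open>p = 2h\<close> and \<open>q = 2g\<close> keeps fractions out of the vector identity.\<close>
    moreover have "p = (1/2) *\<^sub>R p + (1/2) *\<^sub>R p" "q = (1/2) *\<^sub>R q + (1/2) *\<^sub>R q"
      by (simp_all flip: scaleR_add_left)
    then obtain h g where hg: "p = h + h" "q = g + g" "midpoint p q = h + g"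
      by (metis midpoint_def scaleR_add_right inverse_eq_divide)
    moreover have "(\<alpha> * 2) *\<^sub>R v = \<alpha> *\<^sub>R v + \<alpha> *\<^sub>R v" for v :: 'a
      by (simp flip: scaleR_add_left)
    ultimately have "(2 * \<alpha> + 1) *\<^sub>R (y - (h + g)) = \<alpha> *\<^sub>R (w - p) - h + g"
      by (simp add: algebra_simps)
    also have "\<dots> = h + g - x"
      unfolding w(2)[symmetric] by (simp add: hg)
    finally show ?thesis by (simp add: hg(3))
  qed
  ultimately show ?thesis by blast
qed

text \<open>
  The reflections of \<open>K\<close> and of \<open>L\<close> are absorbed by symmetry of the preceding estimate; since the
  absorbed points form a convex set, this passes to the hull.
\<close>

lemma absorbs_reflection_convex_hull_Un:
  fixes p q :: "'a::real_normed_vector"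
  assumes "0 \<le> \<alpha>" and K: "absorbs_reflection \<alpha> p K" and L: "absorbs_reflection \<alpha> q L"
  shows "absorbs_reflection (2 * \<alpha> + 1) (midpoint p q) (convex hull (K \<union> L))"
proof -
  let ?C = "convex hull (K \<union> L)"
  let ?A = "{x. \<exists>y\<in>?C. midpoint p q - x = (2 * \<alpha> + 1) *\<^sub>R (y - midpoint p q)}"
  have pq: "p \<in> K" "q \<in> L" using K L by (auto simp: absorbs_reflection_def)
  have "K \<subseteq> ?A"
    using midpoint_reflection_in_convex_hull_Un[OF assms(1) K pq(2)] by blast
  moreover have "L \<subseteq> ?A"
    using midpoint_reflection_in_convex_hull_Un[OF assms(1) L pq(1)]
    by (auto simp: midpoint_sym Un_commute)
  ultimately have "?C \<subseteq> ?A"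
    by (intro hull_minimal convex_reflections_absorbed) auto
  moreover have "midpoint p q \<in> ?C"
    using convexD[OF convex_convex_hull, of p "K \<union> L" q "1/2" "1/2"] pq
    by (simp add: hull_inc midpoint_def scaleR_add_right)
  ultimately show ?thesis by (auto simp: absorbs_reflection_def)
qed

lemma conv_sum_class_absorbs_reflection:
  assumes "P \<in> conv_sum_class d"
  shows "\<exists>c. absorbs_reflection (2 ^ d - 1) c P"
  using assms
proof (induction d arbitrary: P)
  case 0
  then show ?case by (auto simp: absorbs_reflection_def)
next
  case (Suc d)
  then obtain m :: nat and K L where P: "P = (\<Sum>j=1..m. convex hull (K j \<union> L j))"
    and KL: "\<forall>j\<in>{1..m}. K j \<in> conv_sum_class d \<and> L j \<in> conv_sum_class d"
    by auto
  have "\<forall>j\<in>{1..m}. \<exists>c. absorbs_reflection (2 ^ Suc d - 1) c (convex hull (K j \<union> L j))"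
  proof
    fix j assume "j \<in> {1..m}"
    then obtain p q where "absorbs_reflection (2 ^ d - 1) p (K j)"
      "absorbs_reflection (2 ^ d - 1) q (L j)"
      using KL Suc.IH by blast
    then have "absorbs_reflection (2 * (2 ^ d - 1) + 1) (midpoint p q) (convex hull (K j \<union> L j))"
      by (intro absorbs_reflection_convex_hull_Un) auto
    then show "\<exists>c. absorbs_reflection (2 ^ Suc d - 1) c (convex hull (K j \<union> L j))"
      by (auto simp: algebra_simps)
  qed
  then obtain c where
    "\<And>j. j \<in> {1..m} \<Longrightarrow> absorbs_reflection (2 ^ Suc d - 1) (c j) (convex hull (K j \<union> L j))"
    by metis
  then show ?case
    unfolding P by (intro exI[of _ "\<Sum>j=1..m. c j"] absorbs_reflection_sum) auto
qed

text \<open>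
  A relative interior point \<open>x\<close> and the point \<open>y\<close> absorbing its reflection lie on opposite sides of
  \<open>c\<close>, so \<open>c\<close> is on the segment from \<open>x\<close> to \<open>y\<close> but is not its end \<open>y\<close>.
\<close>

lemma absorbs_reflection_imp_rel_interior:
  fixes K :: "'a::euclidean_space set"
  assumes "convex K" "0 < \<alpha>" and c: "absorbs_reflection \<alpha> c K"
  shows "c \<in> rel_interior K"
proof -
  have "K \<noteq> {}" using c by (auto simp: absorbs_reflection_def)
  then obtain x where x: "x \<in> rel_interior K"
    using rel_interior_eq_empty[OF assms(1)] by blast
  then have "x \<in> K" using rel_interior_subset by blast
  then obtain y where y: "y \<in> K" "c - x = \<alpha> *\<^sub>R (y - c)"
    using c unfolding absorbs_reflection_def by blast
  define e where "e = 1 / (1 + \<alpha>)"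
  have e: "0 < e" "e \<le> 1" using assms(2) by (auto simp: e_def field_simps)
  have "x - y = (1 + \<alpha>) *\<^sub>R (c - y)"
    using y(2) by (simp add: algebra_simps)
  then have "c - y = e *\<^sub>R (x - y)"
    using assms(2) by (simp add: e_def)
  then have "c = y - e *\<^sub>R (y - x)" by (simp add: algebra_simps)
  then show ?thesis
    using rel_interior_convex_shrink[OF assms(1) x y(1) e] by simp
qed

lemma bdd_below_asymmetry_at: "bdd_below (asymmetry_at K ` S)"
proof (rule bdd_belowI2)
  fix c
  let ?A = "{\<alpha>. \<alpha> \<ge> 1 \<and> uminus ` ((\<lambda>x. x - c) ` K) \<subseteq> (\<lambda>x. \<alpha> *\<^sub>R x) ` ((\<lambda>x. x - c) ` K)}"
  \<comment> \<open>Where no factor is admissible, the real infimum takes its default value, independent of \<open>c\<close>.\<close>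
  show "min 1 (Inf {}) \<le> asymmetry_at K c"
  proof (cases "?A = {}")
    case True
    then show ?thesis unfolding asymmetry_at_def True by simp
  next
    case False
    then have "1 \<le> Inf ?A" by (intro cInf_greatest) auto
    then show ?thesis unfolding asymmetry_at_def by simp
  qed
qed

lemma minkowski_measure_le:
  fixes K :: "'a::euclidean_space set"
  assumes "convex K" "1 \<le> \<alpha>" and c: "absorbs_reflection \<alpha> c K"
  shows "minkowski_measure K \<le> \<alpha>"
proof -
  have "- (x - c) \<in> (\<lambda>x. \<alpha> *\<^sub>R x) ` ((\<lambda>x. x - c) ` K)" if "x \<in> K" for x
  proof -
    obtain y where y: "y \<in> K" "c - x = \<alpha> *\<^sub>R (y - c)"
      using c \<open>x \<in> K\<close> unfolding absorbs_reflection_def by blast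
    then have "- (x - c) = \<alpha> *\<^sub>R (y - c)" by simp
    then show ?thesis using y(1) by blast
  qed
  then have "asymmetry_at K c \<le> \<alpha>"
    unfolding asymmetry_at_def using assms(2) by (intro cInf_lower bdd_belowI[of _ 1]) auto
  moreover have "c \<in> rel_interior K"
    using assms by (intro absorbs_reflection_imp_rel_interior[of K \<alpha>]) auto
  ultimately show ?thesis
    unfolding minkowski_measure_def by (intro cINF_lower2 bdd_below_asymmetry_at)
qed

theorem theorem8:
  fixes P :: "(real ^ 'n) set" and k d :: nat
  assumes "polytope P"
    and "\<nexists>x. P = {x}"
    and "aff_dim P = int k"
    and "P \<in> conv_sum_class d"
    and "int d < \<lceil>log 2 (real k + 1)\<rceil>"
  shows "minkowski_measure P \<le> 2 ^ d - 1"
proof -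
  have "d \<noteq> 0" using assms(2,4) by (intro notI) auto
  then have "(2::real) ^ 1 \<le> 2 ^ d" by (intro power_increasing) auto
  then have "(1::real) \<le> 2 ^ d - 1" by simp
  moreover obtain c where "absorbs_reflection (2 ^ d - 1) c P"
    using conv_sum_class_absorbs_reflection[OF assms(4)] by blast
  ultimately show ?thesis
    by (intro minkowski_measure_le polytope_imp_convex assms(1))
qed

end
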